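(* Let $N=RQ$ be a squarefree odd positive integer ($R,Q$ positive integers). Let $v,u\in C^\infty(\mathbb{R})$ with $v$ supported in $[1,2^{3/2}]$ and $u$ supported in $[-1,1]$. If $N$ is divisible by all odd primes $<\frac12(1+2^{3/2})$, then $$\big(v\,\big|\,\Psi(Q^{2i\pi\mathcal{E}}\mathfrak{T}_N)\,u\big)=\sum_{Q_1Q_2=Q}\mu(Q_1)\sum_{R_1|R}\mu(R_1)\,\overline{v}\!\left(\frac{R_1}{Q_2}+\frac{Q_2}{R_1}\right)u\!\left(\frac{R_1}{Q_2}-\frac{Q_2}{R_1}\right),$$ where $Q_1,Q_2,R_1$ range over positive integers.
   Context: $\mu$ is the Möbius function. For $j\ge1$, $a(j)=\prod_{p\text{ prime},\,p|j}(1-p)$, and $\mathfrak{T}_N(x,\xi)=\sum_{j,k\in\mathbb{Z}}a(\gcd(j,k,N))\,\delta(x-j)\delta(\xi-k)$ (with $\gcd(0,0,N)=N$). For $\mathfrak{S}\in\mathcal{S}'(\mathbb{R}^2)$, $\Psi(\mathfrak{S})$ is the operator weakly defined by $(\Psi(\mathfrak{S})u)(x)=\frac12\int_{\mathbb{R}^2}\mathfrak{S}(\frac{x+y}{2},\xi)e^{i\pi(x-y)\xi}u(y)\,dy\,d\xi$, and $(v|w)=\int_{\mathbb{R}}\overline{v}w$; equivalently $(v|\Psi(\mathfrak{S})u)=\langle\mathfrak{S},\mathrm{Wig}(v,u)\rangle$ with $\mathrm{Wig}(v,u)(x,\xi)=\int\overline{v}(x+t)u(x-t)e^{2i\pi\xi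 t}dt$. For $Q>0$, $(Q^{2i\pi\mathcal{E}}\mathfrak{S})(x,\xi)=Q\,\mathfrak{S}(Qx,Q\xi)$. *)

theory Defs
  imports
    "HOL-Analysis.Analysis"
    "HOL-Computational_Algebra.Computational_Algebra"
begin

definition moebius_mu :: "nat \<Rightarrow> int" where
  "moebius_mu n = (if squarefree n then (- 1) ^ card (prime_factors n) else 0)"

definition comb_coeff :: "nat \<Rightarrow> int" where
  "comb_coeff j = (\<Prod>p | prime p \<and> p dvd j. 1 - int p)"

definition smooth :: "(real \<Rightarrow> complex) \<Rightarrow> bool" where
  "smooth f \<longleftrightarrow> (\<exists>D :: nat \<Rightarrow> real \<Rightarrow> complex. D 0 = f \<and>
     (\<forall>n x. (D n has_vector_derivative D (Suc n) x) (at x)))"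

definition supp :: "(real \<Rightarrow> complex) \<Rightarrow> real set" where
  "supp f = closure {x. f x \<noteq> 0}"

text \<open>
  A tempered distribution is represented by its action on test functions, through the bilinear
  (not sesquilinear) pairing: the functional of a locally integrable \<open>S\<close> is
  \<open>h \<mapsto> \<integral> S h\<close>. Only its values on Schwartz functions matter; what it does with other
  functions carries no meaning.
\<close>

type_synonym distr1 = "(real \<Rightarrow> complex) \<Rightarrow> complex"
type_synonym distr2 = "(real \<times> real \<Rightarrow> complex) \<Rightarrow> complex"

definition delta2 :: "real \<Rightarrow> real \<Rightarrow> distr2" where
  "delta2 a b h = h (a, b)"

text \<open>
  On the integers \<open>gcd\<close> is nonnegative and \<open>gcd (gcd 0 0) N = N\<close>, as the definition of the comb
  requires. The series converges absolutely on Schwartz functions, see \<open>comb_summable\<close> below.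
\<close>

definition dirac_comb :: "nat \<Rightarrow> distr2" where
  "dirac_comb N h = (\<Sum>\<^sub>\<infinity>(j, k)\<in>(UNIV :: (int \<times> int) set).
     of_int (comb_coeff (nat (gcd (gcd j k) (int N)))) * delta2 (of_int j) (of_int k) h)"

text \<open>
  \<open>dilate c S\<close> is the distribution \<open>S (c x, c \<xi>)\<close>, defined by duality through the change of
  variables \<open>\<integral>\<integral> S (c x, c \<xi>) h (x, \<xi>) = c\<^sup>-\<^sup>2 \<integral>\<integral> S (x, \<xi>) h (x / c, \<xi> / c)\<close>;
  \<open>euler_power Q\<close> is the operator \<open>Q\<^bsup>2 i \<pi> \<E>\<^esup>\<close>.
\<close>

definition dilate :: "real \<Rightarrow> distr2 \<Rightarrow> distr2" where
  "dilate c S h = S (\<lambda>(x, \<xi>). h (x / c, \<xi> / c)) / of_real (c ^ 2)"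

definition euler_power :: "real \<Rightarrow> distr2 \<Rightarrow> distr2" where
  "euler_power Q S h = of_real Q * dilate Q S h"

definition Wig :: "(real \<Rightarrow> complex) \<Rightarrow> (real \<Rightarrow> complex) \<Rightarrow> real \<times> real \<Rightarrow> complex" where
  "Wig v u = (\<lambda>(x, \<xi>).
     LINT t|lborel. cnj (v (x + t)) * u (x - t) * exp (2 * \<i> * of_real pi * of_real \<xi> * of_real t))"

text \<open>
  The operator with symbol \<open>S\<close>, weakly defined: testing
  \<open>1/2 \<integral>\<integral> S ((x + y) / 2, \<xi>) exp (i \<pi> (x - y) \<xi>) u y dy d\<xi>\<close> against \<open>\<phi> x\<close> and substituting
  \<open>(x, y) = (z + t, z - t)\<close>, whose Jacobian \<open>2\<close> cancels the factor \<open>1/2\<close>, gives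
  the pairing of \<open>S\<close> with the Wigner function of the conjugate of \<open>\<phi>\<close> and \<open>u\<close>.
\<close>

definition Psi :: "distr2 \<Rightarrow> (real \<Rightarrow> complex) \<Rightarrow> distr1" where
  "Psi S u \<phi> = S (Wig (\<lambda>x. cnj (\<phi> x)) u)"

text \<open>
  \<open>(v|w) = \<integral> cnj v w\<close>, antilinear in the first argument, for a distribution \<open>w\<close>.
\<close>

definition pairing :: "(real \<Rightarrow> complex) \<Rightarrow> distr1 \<Rightarrow> complex" where
  "pairing v w = w (\<lambda>x. cnj (v x))"

lemma pairing_Psi: "pairing v (Psi S u) = S (Wig v u)"
  by (simp add: pairing_def Psi_def)

lemma summable_on_int_inverse_square:
  "(\<lambda>j::int. 1 / (1 + (real_of_int j)\<^sup>2)) summable_on UNIV"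
proof -
  let ?f = "\<lambda>j::int. 1 / (1 + (real_of_int j)\<^sup>2)"
  have s: "summable (\<lambda>n::nat. 1 / (1 + (real n)\<^sup>2))"
  proof (rule summable_comparison_test_ev[OF _ inverse_power_summable[of 2, where 'a = real]])
    show "\<forall>\<^sub>F n::nat in sequentially. norm (1 / (1 + (real n)\<^sup>2)) \<le> inverse ((of_nat n :: real) ^ 2)"
      using eventually_gt_at_top[of 0] by eventually_elim (auto simp: inverse_eq_divide intro!: frac_le)
  qed simp
  have n: "(\<lambda>n::nat. 1 / (1 + (real n)\<^sup>2)) summable_on UNIV"
    by (rule norm_summable_imp_summable_on) (use s in simp)
  have p: "?f summable_on range int"
    by (subst summable_on_reindex) (use n in \<open>auto simp: o_def\<close>)
  have m: "?f summable_on range (\<lambda>n. - int n)"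
    by (subst summable_on_reindex) (use n in \<open>auto simp: o_def inj_on_def\<close>)
  have "range int \<union> range (\<lambda>n. - int n) = UNIV"
    by (auto simp: image_iff) (metis int_cases2)
  moreover have "?f summable_on (range int \<union> range (\<lambda>n. - int n))"
    by (rule summable_on_union[OF p m])
  ultimately show ?thesis
    by simp
qed

lemma comb_summable:
  fixes h :: "real \<times> real \<Rightarrow> complex"
  assumes N: "N > 0"
    and h: "\<And>x \<xi>. norm (h (x, \<xi>)) \<le> C / ((1 + x\<^sup>2) * (1 + \<xi>\<^sup>2))"
  shows "(\<lambda>z. norm (case z of (j, k) \<Rightarrow> of_int (comb_coeff (nat (gcd (gcd j k) (int N)))) *
           delta2 (of_int j) (of_int k) h)) summable_on (UNIV :: (int \<times> int) set)"
proof -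
  define M where "M = (\<Sum>d | d dvd N. \<bar>comb_coeff d\<bar>)"
  have fin: "finite {d. d dvd N}"
    using N by simp
  have M: "\<bar>comb_coeff (nat (gcd (gcd j k) (int N)))\<bar> \<le> M" for j k :: int
    unfolding M_def
    by (rule member_le_sum[OF _ _ fin])
      (auto simp: nat_dvd_iff)
  have C: "0 \<le> C"
    using order_trans[OF norm_ge_zero h[of 0 0]] by simp
  have "(\<lambda>(j, k). (1 / (1 + (real_of_int j)\<^sup>2)) * (1 / (1 + (real_of_int k)\<^sup>2)))
          summable_on (UNIV \<times> UNIV :: (int \<times> int) set)"
    by (rule summable_on_SigmaI[where g = "\<lambda>j. (1 / (1 + (real_of_int j)\<^sup>2)) * (\<Sum>\<^sub>\<infinity>k::int. 1 / (1 + (real_of_int k)\<^sup>2))"])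
      (auto intro!: has_sum_cmult_right summable_on_cmult_left summable_on_int_inverse_square
        has_sum_infsum simp del: times_divide_eq_left times_divide_eq_right)
  then have "(\<lambda>z. (of_int M * C) * (case z of (j, k) \<Rightarrow>
        (1 / (1 + (real_of_int j)\<^sup>2)) * (1 / (1 + (real_of_int k)\<^sup>2))))
          summable_on (UNIV :: (int \<times> int) set)"
    by (intro summable_on_cmult_right) simp
  then show ?thesis
  proof (rule summable_on_comparison_test)
    fix z :: "int \<times> int"
    obtain j k where z: "z = (j, k)"
      by (cases z)
    have "norm (of_int (comb_coeff (nat (gcd (gcd j k) (int N)))) * h (of_int j, of_int k)) \<le>
        of_int M * (C / ((1 + (of_int j)\<^sup>2) * (1 + (of_int k)\<^sup>2)))"
      unfolding norm_mult
    proof (rule mult_mono)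
      show "norm (of_int (comb_coeff (nat (gcd (gcd j k) (int N)))) :: complex) \<le> of_int M"
        using M[of j k] by (simp only: norm_of_int of_int_le_iff flip: of_int_abs)
      show "0 \<le> real_of_int M"
        unfolding M_def by (simp add: sum_nonneg)
    qed (use h in auto)
    then show "norm (case z of (j, k) \<Rightarrow> of_int (comb_coeff (nat (gcd (gcd j k) (int N)))) *
        delta2 (of_int j) (of_int k) h) \<le> (of_int M * C) * (case z of (j, k) \<Rightarrow>
        (1 / (1 + (real_of_int j)\<^sup>2)) * (1 / (1 + (real_of_int k)\<^sup>2)))"
      by (simp add: z delta2_def)
  qed auto
qed

end

theory Submission
  imports Defs "HOL-Library.Real_Mod"
begin

text \<open>
  For squarefree \<open>N\<close> the weight \<open>a(gcd(j, k, N))\<close> is the sum of \<open>\<mu>(d) d\<close> over the common divisors \<open>d\<close> of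
  \<open>j\<close>, \<open>k\<close> and \<open>N\<close>, so the comb is a combination of the Dirac combs of the lattices \<open>d\<int> \<times> d\<int>\<close>.
  Since \<open>\<xi> \<mapsto> Wig v u (x, \<xi>)\<close> is the Fourier transform of \<open>t \<mapsto> cnj (v (x + t)) * u (x - t)\<close>, Poisson
  summation in \<open>k\<close> turns the term of \<open>d\<close> into a sum over integers \<open>i\<close>, \<open>l\<close> of the values
  \<open>cnj (v (a + b)) * u (a - b)\<close> with \<open>a = i d / Q\<close> and \<open>b = l Q / d\<close>. There \<open>4 i l = (a + b)\<^sup>2 - (a - b)\<^sup>2\<close>, and
  \<open>v\<close>, \<open>u\<close> vanish also at the end points of the intervals carrying them, so only \<open>i = l = 1\<close>
  contributes. Writing \<open>d = Q\<^sub>1 R\<^sub>1\<close> with \<open>Q = Q\<^sub>1 Q\<^sub>2\<close>, one has \<open>d / Q = R\<^sub>1 / Q\<^sub>2\<close>.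
\<close>

section \<open>Oscillatory integrals and pointwise convergence of Fourier series\<close>

lemma continuous_on_vector_derivative:
  "(\<And>x. (f has_vector_derivative f' x) (at x)) \<Longrightarrow> continuous_on S f"
  by (meson continuous_at_imp_continuous_on has_vector_derivative_continuous)

lemma cis_has_vector_derivative:
  "((\<lambda>t. cis (c * t)) has_vector_derivative of_real c * \<i> * cis (c * t)) (at t within S)"
proof -
  have "((\<lambda>t. c * t) has_derivative (\<lambda>t. c * t)) (at t within S)"
    by (auto intro!: derivative_eq_intros)
  from has_derivative_cis[OF this] show ?thesis
    unfolding has_vector_derivative_def by (rule has_derivative_eq_rhs) (auto simp: scaleR_conv_of_real)
qed

text \<open>Antidifferentiating the exponential gains a factor \<open>1 / c\<close>. One application
  bounds the integrals of polynomials in \<open>riemann_lebesgue\<close>; two give the decay of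
  order \<open>1 / k^2\<close> in \<open>fourier_series_at_0\<close>.\<close>

lemma integral_cis_by_parts:
  fixes p p' :: "real \<Rightarrow> complex"
  assumes "a \<le> b" and p: "\<And>x. (p has_vector_derivative p' x) (at x)"
    and p': "continuous_on UNIV p'" and c: "c \<noteq> 0"
  shows "integral {a..b} (\<lambda>t. p t * cis (c * t)) =
    (p b * cis (c * b) - p a * cis (c * a) - integral {a..b} (\<lambda>t. p' t * cis (c * t))) / (of_real c * \<i>)"
proof -
  have cp: "continuous_on S p" for S
    by (rule continuous_on_vector_derivative[OF p])
  note cp' = continuous_on_subset[OF p' subset_UNIV]
  let ?J = "integral {a..b} (\<lambda>t. p' t * cis (c * t))"
  have J: "((\<lambda>t. p' t * cis (c * t)) has_integral ?J) {a..b}"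
    by (intro integrable_integral integrable_continuous_real continuous_intros cp')
  have "((\<lambda>t. p t * (of_real c * \<i> * cis (c * t)) + p' t * cis (c * t)) has_integral
      p b * cis (c * b) - p a * cis (c * a)) {a..b}"
    by (intro fundamental_theorem_of_calculus has_vector_derivative_mult cis_has_vector_derivative assms
        has_vector_derivative_at_within[OF p])
  from has_integral_diff[OF this J]
  have "((\<lambda>t. of_real c * \<i> * (p t * cis (c * t))) has_integral
      p b * cis (c * b) - p a * cis (c * a) - ?J) {a..b}"
    by (simp add: mult_ac)
  from has_integral_mult_right[OF this, of "inverse (of_real c * \<i>)"]
  have "((\<lambda>t. p t * cis (c * t)) has_integral
      inverse (of_real c * \<i>) * (p b * cis (c * b) - p a * cis (c * a) - ?J)) {a..b}"
    by (rule has_integral_eq[rotated]) (use c in \<open>simp add: field_simps\<close>)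
  then show ?thesis
    by (simp add: integral_unique divide_inverse mult.commute)
qed

lemma norm_integral_le:
  fixes f :: "real \<Rightarrow> complex"
  assumes "continuous_on {0..1} f"
    and "\<And>t. t \<in> {0..1} \<Longrightarrow> norm (f t) \<le> B"
  shows "norm (integral {0..1} f) \<le> B"
  using integral_bound[of 0 1 f B] assms by auto

text \<open>Approximate \<open>g\<close> uniformly on the interval by a polynomial \<open>p\<close>.
  Integration by parts makes the contribution of \<open>p\<close> of order
  \<open>1 / \<bar>c n\<bar>\<close>, while that of \<open>g - p\<close> stays below the
  approximation error for every \<open>n\<close>.\<close>

lemma riemann_lebesgue:
  fixes g :: "real \<Rightarrow> complex" and c :: "nat \<Rightarrow> real"
  assumes g: "continuous_on {0..1} g" and c: "filterlim (\<lambda>n. \<bar>c n\<bar>) at_top sequentially"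
  shows "(\<lambda>n. integral {0..1} (\<lambda>t. g t * cis (c n * t))) \<longlonglongrightarrow> 0"
proof (rule tendstoI, goal_cases)
  case (1 e)
  then have "e / 2 > 0" by simp
  from Stone_Weierstrass_polynomial_function[OF compact_Icc g this]
  obtain p :: "real \<Rightarrow> complex" where p: "polynomial_function p"
    and gp: "\<And>t. t \<in> {0..1} \<Longrightarrow> norm (g t - p t) < e / 2"
    by blast
  obtain p' where p': "polynomial_function p'" "\<And>x. (p has_vector_derivative p' x) (at x)"
    using has_vector_derivative_polynomial_function[OF p] by blast
  have cp: "continuous_on S p" "continuous_on S p'" for S
    using p p' continuous_on_polymonial_function by blast+
  have "compact (p' ` {0..1})"
    by (intro compact_continuous_image cp) auto
  then obtain B where B: "\<And>t. t \<in> {0..1} \<Longrightarrow> norm (p' t) \<le> B"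
    using compact_imp_bounded bounded_iff by (metis (no_types, lifting) imageI)
  define C where "C = norm (p 1) + norm (p 0) + B"
  have bd: "norm (integral {0..1} (\<lambda>t. p t * cis (x * t))) \<le> C / norm x" if "x \<noteq> 0" for x
  proof -
    have "norm (integral {0..1} (\<lambda>t. p' t * cis (x * t))) \<le> B"
      by (intro norm_integral_le continuous_intros cp) (use B in \<open>auto simp: norm_mult\<close>)
    then have "norm (p 1 * cis (x * 1) - p 0 * cis (x * 0) - integral {0..1} (\<lambda>t. p' t * cis (x * t))) \<le> C"
      unfolding C_def
      by (intro order_trans[OF norm_triangle_ineq4] add_mono) (auto simp: norm_mult)
    then show ?thesis
      using that by (subst integral_cis_by_parts[OF _ p'(2) cp(2)])
        (auto simp: norm_divide norm_mult divide_right_mono)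
  qed
  have "(\<lambda>n. C / norm (c n)) \<longlonglongrightarrow> 0"
    unfolding real_norm_def by (rule real_tendsto_divide_at_top[OF tendsto_const c])
  then have "\<forall>\<^sub>F n in sequentially. C / norm (c n) < e / 2"
    using \<open>e / 2 > 0\<close> by (rule order_tendstoD)
  moreover have "\<forall>\<^sub>F n in sequentially. c n \<noteq> 0"
    using eventually_compose_filterlim[OF eventually_gt_at_top[of 0] c] by eventually_elim simp
  ultimately show ?case
  proof eventually_elim
    case (elim n)
    have "integral {0..1} (\<lambda>t. g t * cis (c n * t)) =
        integral {0..1} (\<lambda>t. p t * cis (c n * t)) + integral {0..1} (\<lambda>t. (g t - p t) * cis (c n * t))"
      by (subst integral_add[symmetric])
        (auto intro!: integrable_continuous_real continuous_intros cp g simp: algebra_simps)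
    moreover have "norm (integral {0..1} (\<lambda>t. (g t - p t) * cis (c n * t))) \<le> e / 2"
      by (intro norm_integral_le continuous_intros g cp) (use gp in \<open>force simp: norm_mult\<close>)
    moreover have "norm (integral {0..1} (\<lambda>t. p t * cis (c n * t))) < e / 2"
      using bd[OF elim(2)] elim(1) by (rule order.strict_trans1)
    ultimately show ?case
      using norm_triangle_ineq[of "integral {0..1} (\<lambda>t. p t * cis (c n * t))"
          "integral {0..1} (\<lambda>t. (g t - p t) * cis (c n * t))"]
      by simp
  qed
qed

text \<open>The first-order l'Hopital rule for complex-valued functions of a real variable: both
  differences are divided by \<open>t - a\<close>. It removes the end point singularities of the
  quotient \<open>g\<close> in \<open>fourier_series_at_0\<close>.\<close>

lemma tendsto_quotient_of_differences:
  fixes h E :: "real \<Rightarrow> complex"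
  assumes "(h has_vector_derivative h') (at a)" "(E has_vector_derivative E') (at a)" "E' \<noteq> 0"
  shows "((\<lambda>t. (h t - h a) / (E t - E a)) \<longlongrightarrow> h' / E') (at a)"
proof -
  have q: "((\<lambda>t. (f t - f a) /\<^sub>R (t - a)) \<longlongrightarrow> f') (at a)"
    if "(f has_vector_derivative f') (at a)" for f :: "real \<Rightarrow> complex" and f'
  proof -
    have "((\<lambda>t. norm ((f t - f a) - (t - a) *\<^sub>R f') / norm (t - a)) \<longlongrightarrow> 0) (at a)"
      using that unfolding has_vector_derivative_def has_derivative_iff_norm by blast
    then have "((\<lambda>t. norm ((f t - f a) /\<^sub>R (t - a) - f')) \<longlongrightarrow> 0) (at a)"
    proof (rule Lim_transform_eventually)
      have "norm ((f t - f a) - (t - a) *\<^sub>R f') / norm (t - a) = norm ((f t - f a) /\<^sub>R (t - a) - f')"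
        if "t \<noteq> a" for t
      proof -
        have "(f t - f a) /\<^sub>R (t - a) - f' = ((f t - f a) - (t - a) *\<^sub>R f') /\<^sub>R (t - a)"
          using that by (simp add: scaleR_diff_right)
        then show ?thesis by (simp add: divide_inverse mult.commute)
      qed
      then show "\<forall>\<^sub>F t in at a. norm ((f t - f a) - (t - a) *\<^sub>R f') / norm (t - a) =
          norm ((f t - f a) /\<^sub>R (t - a) - f')"
        by (simp add: eventually_at_filter)
    qed
    then show ?thesis
      by (rule LIM_zero_cancel[OF tendsto_norm_zero_cancel])
  qed
  have "((\<lambda>t. ((h t - h a) /\<^sub>R (t - a)) / ((E t - E a) /\<^sub>R (t - a))) \<longlongrightarrow> h' / E') (at a)"
    by (intro tendsto_divide q assms)
  then show ?thesis
    by (rule Lim_transform_eventually) 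
      (auto simp: eventually_at_filter scaleR_conv_of_real divide_simps)
qed

text \<open>Equal end point values of \<open>h\<close> and \<open>h'\<close> cancel the boundary
  terms of two integrations by parts, so the coefficients decay like \<open>1 / k^2\<close> and the
  series converges absolutely. Its sum may then be computed along symmetric partial sums.\<close>

lemma fourier_series_at_0:
  fixes h h' h'' :: "real \<Rightarrow> complex"
  assumes h: "\<And>x. (h has_vector_derivative h' x) (at x)"
    and h': "\<And>x. (h' has_vector_derivative h'' x) (at x)"
    and h'': "continuous_on UNIV h''"
    and per: "h 1 = h 0" "h' 1 = h' 0"
  shows "((\<lambda>k::int. integral {0..1} (\<lambda>t. h t * cis (2 * pi * of_int k * t))) has_sum h 0) UNIV"
proof -
  let ?e = "\<lambda>k t. cis (2 * pi * of_int k * t)"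
  define c where "c = (\<lambda>k::int. integral {0..1} (\<lambda>t. h t * ?e k t))"
  have ch: "continuous_on S h" "continuous_on S h'" for S
    by (rule continuous_on_vector_derivative[OF h] continuous_on_vector_derivative[OF h'])+
  note ch'' = continuous_on_subset[OF h'' subset_UNIV]
  have e1: "?e k 1 = 1" for k
    unfolding cis_eq_1_iff by (rule exI[of _ k]) (simp add: mult_ac)
  have "compact (h'' ` {0..1})"
    by (intro compact_continuous_image ch'') auto
  then obtain B where B: "\<And>t. t \<in> {0..1} \<Longrightarrow> norm (h'' t) \<le> B"
    using compact_imp_bounded bounded_iff by (metis (no_types, lifting) imageI)
  \<comment> \<open>One constant for all \<open>k\<close>: \<open>norm (c 0)\<close> covers
    \<open>k = 0\<close>, and \<open>2 * B\<close> covers \<open>k \<noteq> 0\<close>, where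
    \<open>1 + k^2 \<le> 2 * k^2\<close> and \<open>(2 * pi)^2 \<ge> 1\<close>.\<close>
  define C where "C = 2 * B + norm (c 0)"
  have B0: "B \<ge> 0" using order_trans[OF norm_ge_zero B[of 0]] by simp
  have bd: "norm (c k) \<le> C * (1 / (1 + (real_of_int k)\<^sup>2))" for k
  proof (cases "k = 0")
    case True then show ?thesis using B0 by (simp add: C_def)
  next
    case False
    then have k: "2 * pi * of_int k \<noteq> 0" by simp
    let ?J = "integral {0..1} (\<lambda>t. h'' t * ?e k t)"
    have "c k = ?J / (of_real (2 * pi * of_int k) * \<i>)\<^sup>2"
      unfolding c_def integral_cis_by_parts[OF zero_le_one h ch(2) k]
        integral_cis_by_parts[OF zero_le_one h' h'' k] e1 per by (simp add: power2_eq_square)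
    moreover have "norm ?J \<le> B"
      by (intro norm_integral_le continuous_intros ch'') (use B in \<open>auto simp: norm_mult\<close>)
    ultimately have "norm (c k) \<le> B / (2 * pi * of_int k)\<^sup>2"
      by (simp add: norm_divide norm_mult norm_power power_mult_distrib divide_right_mono)
    also have "\<dots> \<le> B / ((1 + (real_of_int k)\<^sup>2) / 2)"
    proof (intro divide_left_mono B0 mult_pos_pos)
      have "1 \<le> (real_of_int k)\<^sup>2"
        using False by (smt (verit) int_one_le_iff_zero_less of_int_1 of_int_le_iff of_int_power zero_less_power2)
      moreover have "1 * 1 \<le> (2 * pi) * (2 * pi)"
        using pi_gt3 by (intro mult_mono) auto
      ultimately show "(1 + (real_of_int k)\<^sup>2) / 2 \<le> (2 * pi * of_int k)\<^sup>2"
        using mult_right_mono[of 1 "(2 * pi) * (2 * pi)" "(real_of_int k)\<^sup>2"]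
        by (simp add: power2_eq_square mult_ac)
    qed (use False in \<open>auto simp: add_pos_nonneg\<close>)
    also have "\<dots> \<le> C / (1 + (real_of_int k)\<^sup>2)"
      by (simp add: C_def divide_right_mono mult.commute)
    finally show ?thesis by simp
  qed
  have "c summable_on UNIV"
    by (rule abs_summable_summable, rule summable_on_comparison_test[OF summable_on_cmult_right[OF summable_on_int_inverse_square]])
      (use bd in auto)
  then obtain S where S: "(c has_sum S) UNIV" by (auto simp: summable_on_def)
  have "filterlim (\<lambda>n. {- int n..<int n}) (finite_subsets_at_top UNIV) sequentially"
    unfolding filterlim_finite_subsets_at_top
  proof safe
    fix X :: "int set" assume "finite X"
    \<comment> \<open>The sum of the absolute values bounds each of them and, unlike a maximum, also
      makes sense for empty \<open>X\<close>.\<close>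
    define m where "m = (\<Sum>x\<in>X. \<bar>x\<bar>)"
    have m: "\<bar>x\<bar> \<le> m" if "x \<in> X" for x
      unfolding m_def using that \<open>finite X\<close> by (intro member_le_sum) auto
    show "\<forall>\<^sub>F n in sequentially. finite {- int n..<int n} \<and> X \<subseteq> {- int n..<int n} \<and> {- int n..<int n} \<subseteq> UNIV"
      using eventually_gt_at_top[of "nat m"] by eventually_elim (use m in fastforce)
  qed
  with S have lim: "(\<lambda>n. sum c {- int n..<int n}) \<longlonglongrightarrow> S"
    unfolding has_sum_def by (rule filterlim_compose)
  \<comment> \<open>\<open>h - h 0 = g (e\<^sub>1 - 1)\<close> makes the symmetric partial sums telescope to two Fourier coefficients of
    the continuous function \<open>g\<close>, which tend to \<open>0\<close> by the Riemann-Lebesgue lemma.\<close>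
  define g where "g t = (if t = 0 \<or> t = 1 then h' 0 / (2 * of_real pi * \<i>) else (h t - h 0) / (?e 1 t - 1))" for t
  have ne: "?e 1 t \<noteq> 1" if "0 < t" "t < 1" for t
  proof
    assume "?e 1 t = 1"
    then obtain n :: int where "2 * pi * t = of_int n * (2 * pi)" unfolding cis_eq_1_iff by auto
    then have "t = of_int n" by simp
    with that show False by auto
  qed
  have g: "continuous_on {0..1} g"
  proof (unfold continuous_on_def, rule ballI)
    fix a :: real assume a: "a \<in> {0..1}"
    show "(g \<longlongrightarrow> g a) (at a within {0..1})"
    proof (cases "a = 0 \<or> a = 1")
      case True
      \<comment> \<open>By periodicity both end points have the same data, so one limit computation
        serves both and yields the value given to \<open>g\<close> there.\<close>
      have 1: "h a = h 0" "h' a = h' 0" "?e 1 a = 1" using True per e1[of 1] by auto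
      have "((\<lambda>t. (h t - h a) / (?e 1 t - ?e 1 a)) \<longlongrightarrow> h' a / (of_real (2 * pi * of_int 1) * \<i> * ?e 1 a)) (at a)"
        by (rule tendsto_quotient_of_differences[where h = h and E = "?e 1", OF h[of a]])
          (rule cis_has_vector_derivative[of "2 * pi * of_int 1"], simp)
      then have "((\<lambda>t. (h t - h 0) / (?e 1 t - 1)) \<longlongrightarrow> g a) (at a within {0..1})"
        unfolding 1 using True by (auto simp: g_def intro: tendsto_within_subset)
      then show ?thesis
      proof (rule Lim_transform_eventually)
        show "\<forall>\<^sub>F t in at a within {0..1}. (h t - h 0) / (?e 1 t - 1) = g t"
          unfolding eventually_at using True 
          by (intro exI[of _ 1]) (auto simp: g_def dist_real_def)
      qed
    next
      case False
      have "((\<lambda>t. (h t - h 0) / (?e 1 t - 1)) \<longlongrightarrow> (h a - h 0) / (?e 1 a - 1)) (at a)"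
        by (rule isContD, intro continuous_divide continuous_diff continuous_const
            has_vector_derivative_continuous[OF h]
            has_vector_derivative_continuous[OF cis_has_vector_derivative])
          (use False a ne[of a] in auto)
      then have "((\<lambda>t. (h t - h 0) / (?e 1 t - 1)) \<longlongrightarrow> g a) (at a within {0..1})"
        unfolding g_def using False by (auto intro: tendsto_within_subset)
      then show ?thesis
      proof (rule Lim_transform_eventually)
        have "\<forall>\<^sub>F t in at a within {0..1}. t \<noteq> 0 \<and> t \<noteq> 1"
          unfolding eventually_at using False a 
          by (intro exI[of _ "min a (1 - a)"]) (auto simp: dist_real_def)
        then show "\<forall>\<^sub>F t in at a within {0..1}. (h t - h 0) / (?e 1 t - 1) = g t"
          by eventually_elim (simp add: g_def)
      qed
    qed
  qed
  define G where "G = (\<lambda>k::int. integral {0..1} (\<lambda>t. g t * ?e k t))"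
  have e0: "integral {0..1} (?e k) = (if k = 0 then 1 else 0)" for k
  proof (cases "k = 0")
    case False
    then show ?thesis 
      using integral_cis_by_parts[of 0 1 "\<lambda>_. 1" "\<lambda>_. 0" "2 * pi * of_int k"] e1[of k]
      by simp
  qed auto
  have tele: "c k = (if k = 0 then h 0 else 0) + G (k + 1) - G k" for k
  proof -
    have "h t * ?e k t = h 0 * ?e k t + (g t * ?e (k + 1) t - g t * ?e k t)" if "t \<in> {0..1}" for t
    proof -
      have 1: "h t - h 0 = g t * (?e 1 t - 1)"
        using per e1[of 1] that ne[of t] by (cases "t = 0 \<or> t = 1") (auto simp: g_def)
      have 2: "?e (k + 1) t = ?e k t * ?e 1 t"
        by (simp add: cis_mult algebra_simps)
      have "h t * ?e k t = h 0 * ?e k t + (h t - h 0) * ?e k t"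
        by (simp add: left_diff_distrib)
      then show ?thesis
        unfolding 1 2 by (simp add: algebra_simps)
    qed
    then have "c k = integral {0..1} (\<lambda>t. h 0 * ?e k t + (g t * ?e (k + 1) t - g t * ?e k t))"
      unfolding c_def by (rule integral_cong)
    also have "\<dots> = integral {0..1} (\<lambda>t. h 0 * ?e k t) + (G (k + 1) - G k)"
    proof -
      have i: "(\<lambda>t. h 0 * ?e k t) integrable_on {0..1}" "(\<lambda>t. g t * ?e k t) integrable_on {0..1}" for k
        by (intro integrable_continuous_real continuous_intros g)+
      show ?thesis
        unfolding G_def by (simp only: integral_add[OF i(1) integrable_diff[OF i(2) i(2)]] integral_diff[OF i(2) i(2)])
    qed
    finally show ?thesis
      by (simp add: e0)
  qed
  \<comment> \<open>The induction starts at \<open>n = 1\<close>: the term \<open>h 0\<close> comes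
    from \<open>k = 0\<close>, which the empty range for \<open>n = 0\<close> does not
    contain.\<close>
  have sumc: "sum c {- int n..<int n} = h 0 + G (int n) - G (- int n)" if "n > 0" for n
    using that
  proof (induction n rule: nat_induct_non_zero)
    case 1
    have "{- int 1..<int 1} = {-1, 0}" by auto
    then show ?case by (simp add: tele)
  next
    case (Suc n)
    have "{- int (Suc n)..<int (Suc n)} = insert (- 1 - int n) (insert (int n) {- int n..<int n})" by auto
    then show ?case using Suc by (simp add: tele algebra_simps)
  qed
  have lin: "filterlim (\<lambda>n. 2 * pi * real n) at_top sequentially"
    by (rule filterlim_tendsto_pos_mult_at_top[OF tendsto_const _ filterlim_real_sequentially]) simp
  have "(\<lambda>n. G (int n)) \<longlonglongrightarrow> 0"
    unfolding G_def by (rule riemann_lebesgue[OF g]) (use lin in \<open>simp add: abs_mult\<close>)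
  moreover have "(\<lambda>n. G (- int n)) \<longlonglongrightarrow> 0"
    unfolding G_def by (rule riemann_lebesgue[OF g]) (use lin in \<open>simp add: abs_mult\<close>)
  ultimately have "(\<lambda>n. h 0 + G (int n) - G (- int n)) \<longlonglongrightarrow> h 0"
    using tendsto_diff[OF tendsto_add[OF tendsto_const], of "\<lambda>n. G (int n)" 0 sequentially _ 0 "h 0"] by simp
  moreover have "\<forall>\<^sub>F n in sequentially. h 0 + G (int n) - G (- int n) = sum c {- int n..<int n}"
    using eventually_gt_at_top[of 0] by eventually_elim (rule sumc[symmetric])
  ultimately have "(\<lambda>n. sum c {- int n..<int n}) \<longlonglongrightarrow> h 0"
    by (rule Lim_transform_eventually)
  with lim have "S = h 0" by (rule LIMSEQ_unique)
  with S show ?thesis by (simp add: c_def)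
qed

section \<open>Twice continuously differentiable functions\<close>

text \<open>Two continuous derivatives are what \<open>fourier_series_at_0\<close> consumes. Closure
  under products then takes two explicit formulas, where \<open>smooth\<close> would call for the
  Leibniz rule at every order.\<close>

definition C2 :: "(real \<Rightarrow> complex) \<Rightarrow> bool" where
  "C2 f \<longleftrightarrow> (\<exists>f' f''. (\<forall>x. (f has_vector_derivative f' x) (at x)) \<and>
     (\<forall>x. (f' has_vector_derivative f'' x) (at x)) \<and> continuous_on UNIV f'')"

lemma C2I:
  "\<lbrakk>\<And>x. (f has_vector_derivative f' x) (at x); \<And>x. (f' has_vector_derivative f'' x) (at x);
    continuous_on UNIV f''\<rbrakk> \<Longrightarrow> C2 f"
  unfolding C2_def by blast

lemma C2_continuous: "C2 f \<Longrightarrow> continuous_on S f"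
  unfolding C2_def using continuous_on_vector_derivative by blast

lemma smooth_imp_C2:
  assumes "smooth f"
  shows "C2 f"
proof -
  obtain D where D: "D 0 = f" "\<And>n x. (D n has_vector_derivative D (Suc n) x) (at x)"
    using assms unfolding smooth_def by blast
  have "continuous_on UNIV (D 2)"
    by (rule continuous_on_vector_derivative[OF D(2)])
  then show ?thesis
    unfolding C2_def using D(1) D(2)[of 0] D(2)[of 1]
    by (intro exI[of _ "D 1"] exI[of _ "D 2"]) (auto simp: numeral_2_eq_2)
qed

lemma C2_cnj:
  assumes "C2 f"
  shows "C2 (\<lambda>t. cnj (f t))"
proof -
  obtain f' f'' where f: "\<And>x. (f has_vector_derivative f' x) (at x)"
    "\<And>x. (f' has_vector_derivative f'' x) (at x)" "continuous_on UNIV f''"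
    using assms unfolding C2_def by blast
  show ?thesis
    unfolding C2_def
    by (intro exI[of _ "\<lambda>t. cnj (f' t)"] exI[of _ "\<lambda>t. cnj (f'' t)"] conjI allI
        has_vector_derivative_cnj f continuous_intros)
qed

lemma C2_affine:
  assumes "C2 f"
  shows "C2 (\<lambda>t. f (a + b * t))"
proof -
  obtain f' f'' where f: "\<And>x. (f has_vector_derivative f' x) (at x)"
    "\<And>x. (f' has_vector_derivative f'' x) (at x)" "continuous_on UNIV f''"
    using assms unfolding C2_def by blast
  have d: "((\<lambda>t. g (a + b * t)) has_vector_derivative b *\<^sub>R g' (a + b * x)) (at x)"
    if "\<And>x. (g has_vector_derivative g' x) (at x)" for g g' :: "real \<Rightarrow> complex" and x
  proof -
    have "((\<lambda>t. a + b * t) has_vector_derivative b) (at x)"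
      by (auto intro!: derivative_eq_intros simp flip: has_real_derivative_iff_has_vector_derivative)
    from vector_diff_chain_at[OF this that] show ?thesis by (simp add: o_def)
  qed
  have "((\<lambda>t. b *\<^sub>R f' (a + b * t)) has_vector_derivative b *\<^sub>R b *\<^sub>R f'' (a + b * x)) (at x)" for x
    using has_vector_derivative_scaleR[OF DERIV_const d[OF f(2)], of b x] by simp
  moreover have "continuous_on UNIV (\<lambda>t. b *\<^sub>R b *\<^sub>R f'' (a + b * t))"
    by (intro continuous_intros continuous_on_compose2[OF f(3)]) auto
  ultimately show ?thesis
    by (rule C2I[OF d[OF f(1)]])
qed

lemma C2_mult:
  assumes "C2 f" "C2 g"
  shows "C2 (\<lambda>t. f t * g t)"
proof -
  obtain f' f'' where f: "\<And>x. (f has_vector_derivative f' x) (at x)"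
    "\<And>x. (f' has_vector_derivative f'' x) (at x)" "continuous_on UNIV f''"
    using assms unfolding C2_def by blast
  obtain g' g'' where g: "\<And>x. (g has_vector_derivative g' x) (at x)"
    "\<And>x. (g' has_vector_derivative g'' x) (at x)" "continuous_on UNIV g''"
    using assms unfolding C2_def by blast
  note c = continuous_on_vector_derivative[OF f(1)] continuous_on_vector_derivative[OF f(2)]
    continuous_on_vector_derivative[OF g(1)] continuous_on_vector_derivative[OF g(2)] f(3) g(3)
  show ?thesis
    unfolding C2_def
    by (intro exI[of _ "\<lambda>t. f t * g' t + f' t * g t"]
        exI[of _ "\<lambda>t. (f t * g'' t + f' t * g' t) + (f' t * g' t + f'' t * g t)"] conjI allI
        has_vector_derivative_add has_vector_derivative_mult f(1,2) g(1,2) continuous_intros c)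
qed

lemma C2_sum:
  assumes "\<And>i. i \<in> I \<Longrightarrow> C2 (f i)"
  shows "C2 (\<lambda>t. \<Sum>i\<in>I. f i t)"
proof -
  have "\<forall>i\<in>I. \<exists>f' f''. (\<forall>x. (f i has_vector_derivative f' x) (at x)) \<and>
     (\<forall>x. (f' has_vector_derivative f'' x) (at x)) \<and> continuous_on UNIV f''"
    using assms unfolding C2_def by blast
  then obtain f' f'' where f: "\<And>i x. i \<in> I \<Longrightarrow> (f i has_vector_derivative f' i x) (at x)"
    "\<And>i x. i \<in> I \<Longrightarrow> (f' i has_vector_derivative f'' i x) (at x)" "\<And>i. i \<in> I \<Longrightarrow> continuous_on UNIV (f'' i)"
    by metis
  show ?thesis
    unfolding C2_def
    by (intro exI[of _ "\<lambda>t. \<Sum>i\<in>I. f' i t"] exI[of _ "\<lambda>t. \<Sum>i\<in>I. f'' i t"] conjI allI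
        has_vector_derivative_sum f continuous_intros)
qed

section \<open>Poisson summation\<close>

lemma sum_integral_unit_intervals:
  fixes F :: "real \<Rightarrow> complex"
  assumes F: "continuous_on UNIV F"
  shows "(\<Sum>l\<in>{- int m..<int m}. integral {of_int l..of_int l + 1} F) = integral {- real m..real m} F"
proof (induction m)
  case (Suc m)
  have i: "F integrable_on {a..b}" for a b
    by (intro integrable_continuous_real continuous_on_subset[OF F]) simp
  have eq: "{- int (Suc m)..<int (Suc m)} = insert (- int m - 1) (insert (int m) {- int m..<int m})" by auto
  have "integral {- real (Suc m)..real (Suc m)} F =
      integral {- 1 - real m..- real m} F + (integral {- real m..real m} F + integral {real m..1 + real m} F)"
    using Henstock_Kurzweil_Integration.integral_combine[OF _ _ i, of "- 1 - real m" "- real m" "1 + real m"]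
      Henstock_Kurzweil_Integration.integral_combine[OF _ _ i, of "- real m" "real m" "1 + real m"] by (simp add: add.commute)
  moreover have e: "- real m - 1 = - 1 - real m" "real m + 1 = 1 + real m" by simp_all
  ultimately show ?case
    unfolding eq by (simp add: Suc.IH e)
qed simp

text \<open>Passes from the Lebesgue integral in \<open>Wig\<close> to the gauge integral, in which
  the integration by parts and the splitting into unit intervals take place.\<close>

lemma LINT_eq_integral:
  fixes F :: "real \<Rightarrow> complex"
  assumes F: "continuous_on UNIV F" and z: "\<And>t. \<bar>t\<bar> > m \<Longrightarrow> F t = 0"
  shows "(LINT t|lborel. F t) = integral {- m..m} F"
proof -
  have "set_integrable lborel {- m..m} F"
    by (intro borel_integrable_atLeastAtMost' continuous_on_subset[OF F]) simp
  from set_borel_integral_eq_integral(2)[OF this]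
  have "(LINT t:{- m..m}|lborel. F t) = integral {- m..m} F" .
  moreover have "(\<lambda>t. indicator {- m..m} t *\<^sub>R F t) = F"
    using z by (force simp: indicator_def)
  ultimately show ?thesis by (simp add: set_lebesgue_integral_def)
qed

text \<open>The sum \<open>h\<close> of integer translates of \<open>f\<close> has as Fourier
  coefficients the integrals of \<open>f\<close> over the line, since the exponentials have period 1
  and the unit intervals tile the support. The claim is the Fourier series of \<open>h\<close> at
  0.\<close>

lemma poisson_summation_compact_support:
  assumes C2: "C2 f" and z: "\<And>t. \<bar>t\<bar> > real M \<Longrightarrow> f t = 0"
  shows "((\<lambda>k::int. LINT t|lborel. f t * cis (2 * pi * of_int k * t)) has_sum
    (\<Sum>l\<in>{- int M - 1..int M}. f (of_int l))) UNIV"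
proof -
  let ?I = "{- int M - 1..int M}"
  \<comment> \<open>For \<open>t\<close> in \<open>{0..1}\<close> these \<open>l\<close> include all
    with \<open>f (l + t) \<noteq> 0\<close>; the extra index \<open>- M - 1\<close> is needed when
    \<open>t = 1\<close>. The factor \<open>1\<close> matches \<open>C2_affine\<close>.\<close>
  define h where "h t = (\<Sum>l\<in>?I. f (of_int l + 1 * t))" for t
  have "C2 h"
    unfolding h_def by (intro C2_sum C2_affine C2)
  then obtain h' h'' where h: "\<And>x. (h has_vector_derivative h' x) (at x)"
    "\<And>x. (h' has_vector_derivative h'' x) (at x)" "continuous_on UNIV h''"
    unfolding C2_def by blast
  \<comment> \<open>The finite sum \<open>h\<close> need not be periodic on the whole line, but both
    correction terms vanish for \<open>\<bar>t\<bar> < 1\<close>, which suffices for the conditions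
    at 0 and 1.\<close>
  have shift: "h (t + 1) = h t + f (real M + 1 + t) - f (- real M - 1 + t)" for t
  proof -
    have "h (t + 1) = (\<Sum>l\<in>{- int M..int M + 1}. f (of_int l + t))"
      unfolding h_def
      by (rule sum.reindex_bij_witness[of _ "\<lambda>l. l - 1" "\<lambda>l. l + 1"]) (auto simp: algebra_simps)
    also have "{- int M..int M + 1} = insert (int M + 1) {- int M..int M}" by auto
    also have "(\<Sum>l\<in>\<dots>. f (of_int l + t)) = f (real M + 1 + t) + (\<Sum>l\<in>{- int M..int M}. f (of_int l + t))"
      by simp
    finally have 1: "h (t + 1) = \<dots>" .
    have "?I = insert (- int M - 1) {- int M..int M}" by auto
    then have "h t = f (- real M - 1 + t) + (\<Sum>l\<in>{- int M..int M}. f (of_int l + t))"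
      unfolding h_def by simp
    with 1 show ?thesis by simp
  qed
  \<comment> \<open>The derivative of \<open>h (t + 1)\<close> at 0 is found twice, by the chain
    rule and from \<open>h (t + 1) = h t\<close> near 0, whence \<open>h' 1 = h' 0\<close>.\<close>
  have "((\<lambda>t. h (t + 1)) has_vector_derivative h' 1) (at 0)"
  proof -
    have "((\<lambda>t. t + 1) has_vector_derivative 1) (at (0::real))"
      by (auto intro!: derivative_eq_intros simp flip: has_real_derivative_iff_has_vector_derivative)
    from vector_diff_chain_at[OF this, of h "h' 1"] h(1)[of 1] show ?thesis
      by (simp add: o_def)
  qed
  moreover have "((\<lambda>t. h (t + 1)) has_vector_derivative h' 0) (at 0)"
    by (rule has_vector_derivative_transform_within[OF h(1)[of 0], of 1]) (auto simp: dist_real_def shift z)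
  ultimately have "h' 1 = h' 0"
    by (rule vector_derivative_unique_at)
  moreover have "h 1 = h 0"
    using shift[of 0] z by simp
  ultimately have "((\<lambda>k::int. integral {0..1} (\<lambda>t. h t * cis (2 * pi * of_int k * t))) has_sum h 0) UNIV"
    by (intro fourier_series_at_0[OF h])
  moreover have "integral {0..1} (\<lambda>t. h t * cis (2 * pi * of_int k * t)) =
      (LINT t|lborel. f t * cis (2 * pi * of_int k * t))" for k
  proof -
    let ?F = "\<lambda>t. f t * cis (2 * pi * of_int k * t)"
    have F: "continuous_on S ?F" for S
      by (intro continuous_intros C2_continuous C2)
    have per: "cis (2 * pi * of_int k * (of_int l + t)) = cis (2 * pi * of_int k * t)" for l t
    proof -
      have "cis (2 * pi * of_int k * of_int l) = 1"
        unfolding cis_eq_1_iff by (rule exI[of _ "k * l"]) simp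
      then show ?thesis
        by (simp add: distrib_left flip: cis_mult)
    qed
    have "integral {0..1} (\<lambda>t. h t * cis (2 * pi * of_int k * t)) =
        integral {0..1} (\<lambda>t. \<Sum>l\<in>?I. ?F (of_int l + t))"
      unfolding h_def sum_distrib_right per by simp
    also have "\<dots> = (\<Sum>l\<in>?I. integral {0..1} (\<lambda>t. ?F (of_int l + t)))"
      by (intro integral_sum integrable_continuous_real continuous_on_compose2[OF F] continuous_intros) auto
    also have "\<dots> = (\<Sum>l\<in>?I. integral {of_int l..of_int l + 1} ?F)"
    proof (rule sum.cong[OF refl])
      show "integral {0..1} (\<lambda>t. ?F (of_int l + t)) = integral {of_int l..of_int l + 1} ?F" for l
        using integral_shift_Icc_real[of 0 1 ?F "of_int l"] by (simp only: o_def add_0 add.commute[of 1])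
    qed
    also have "?I = {- int (M + 1)..<int (M + 1)}" by auto
    also have "(\<Sum>l\<in>\<dots>. integral {of_int l..of_int l + 1} ?F) = integral {- real (M + 1)..real (M + 1)} ?F"
      by (rule sum_integral_unit_intervals[OF F])
    also have "\<dots> = (LINT t|lborel. ?F t)"
      by (rule LINT_eq_integral[symmetric, OF F]) (use z in auto)
    finally show ?thesis .
  qed
  ultimately show ?thesis
    by (simp add: h_def)
qed

text \<open>Scaling by \<open>T\<close> reduces this to the unit lattice. \<open>L\<close> is left
  free so that the dual sum can run over whichever finite set is known to contain its nonzero
  terms.\<close>

lemma poisson_summation:
  assumes C2: "C2 f" and z: "\<And>t. \<bar>t\<bar> > A \<Longrightarrow> f t = 0" and T: "T > 0"
    and L: "finite L" "\<And>l::int. l \<notin> L \<Longrightarrow> f (of_int l * T) = 0"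
  shows "((\<lambda>k::int. LINT t|lborel. f t * cis (2 * pi * (of_int k / T) * t)) has_sum
    of_real T * (\<Sum>l\<in>L. f (of_int l * T))) UNIV"
proof -
  obtain M :: nat where M: "real M \<ge> A / T" using real_arch_simple by blast
  define g where "g t = f (0 + T * t)" for t
  have g: "C2 g" unfolding g_def by (rule C2_affine[OF C2])
  have gz: "g t = 0" if "\<bar>t\<bar> > real M" for t
  proof -
    have "A / T < \<bar>t\<bar>" using M that by simp
    then have "\<bar>T * t\<bar> > A" using T by (simp add: abs_mult pos_divide_less_eq mult.commute)
    then show ?thesis by (simp add: g_def z)
  qed
  let ?I = "{- int M - 1..int M}"
  have "(LINT t|lborel. f t * cis (2 * pi * (of_int k / T) * t)) =
      of_real T * (LINT t|lborel. g t * cis (2 * pi * of_int k * t))" for k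
    using lborel_integral_real_affine[of T "\<lambda>t. f t * cis (2 * pi * (of_int k / T) * t)" 0] T
    by (simp add: g_def scaleR_conv_of_real mult.assoc)
  \<comment> \<open>Terms of \<open>L\<close> outside the interval vanish by the support of
    \<open>f\<close>, terms of the interval outside \<open>L\<close> by the choice of
    \<open>L\<close>.\<close>
  moreover have "(\<Sum>l\<in>?I. g (of_int l)) = (\<Sum>l\<in>L. f (of_int l * T))"
  proof (rule sum.mono_neutral_cong)
    fix l assume "l \<in> L - ?I"
    then have "\<bar>real_of_int l\<bar> > real M" by auto
    from gz[OF this] show "f (of_int l * T) = 0" by (simp add: g_def mult.commute)
  qed (use L in \<open>auto simp: g_def mult.commute\<close>)
  ultimately show ?thesis
    using has_sum_cmult_right[OF poisson_summation_compact_support[where M = M, OF g gz], where c = "complex_of_real T"] by simp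
qed

section \<open>Moebius function and sums over divisors\<close>

lemma prod_prime_factors_squarefree:
  fixes n :: nat
  assumes "squarefree n"
  shows "\<Prod>(prime_factors n) = n"
proof -
  have "n \<noteq> 0" using assms by (metis not_squarefree_0)
  then have "n = (\<Prod>p\<in>prime_factors n. p ^ multiplicity p n)"
    by (intro prime_factorization_nat) simp
  also have "\<dots> = \<Prod>(prime_factors n)"
    using assms \<open>n \<noteq> 0\<close> by (intro prod.cong) (auto simp: squarefree_factorial_semiring')
  finally show ?thesis ..
qed

lemma prime_factors_prod_primes:
  assumes "finite X" "\<And>p. p \<in> X \<Longrightarrow> prime (p :: nat)"
  shows "prime_factors (\<Prod>X) = X"
  using assms by (subst prime_factors_prod) (force simp: prime_factorization_prime)+

text \<open>Expanding the product over primes gives one term for each set of prime factors, and for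
  squarefree \<open>n\<close> these sets correspond to the divisors of \<open>n\<close> by taking
  products.\<close>

lemma comb_coeff_eq_sum_divisors:
  assumes n: "squarefree n"
  shows "comb_coeff n = (\<Sum>d | d dvd n. moebius_mu d * int d)"
proof -
  let ?P = "prime_factors n"
  have n0: "n \<noteq> 0" using n by (metis not_squarefree_0)
  have "comb_coeff n = (\<Prod>p\<in>?P. - int p + 1)"
    unfolding comb_coeff_def by (rule prod.cong) (use n0 in \<open>auto simp: prime_factors_dvd\<close>)
  also have "\<dots> = (\<Sum>X\<in>Pow ?P. (\<Prod>p\<in>X. - int p))"
    by (subst prod_add) simp_all
  also have "\<dots> = (\<Sum>d | d dvd n. moebius_mu d * int d)"
  proof (rule sum.reindex_bij_witness[of _ prime_factors "\<lambda>X. \<Prod>X"])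
    fix X assume X: "X \<in> Pow ?P"
    then have fin: "finite X" and p: "\<And>p. p \<in> X \<Longrightarrow> prime p"
      by (auto intro: finite_subset)
    show pf: "prime_factors (\<Prod>X) = X"
      by (rule prime_factors_prod_primes[OF fin p])
    have "\<Prod>X dvd \<Prod>?P"
      using X by (intro prod_dvd_prod_subset) auto
    then show d: "\<Prod>X \<in> {d. d dvd n}"
      by (simp add: prod_prime_factors_squarefree[OF n])
    then have "squarefree (\<Prod>X)"
      using n squarefree_mono by blast
    then show "moebius_mu (\<Prod>X) * int (\<Prod>X) = (\<Prod>p\<in>X. - int p)"
      by (simp add: moebius_mu_def pf prod_uminus)
  next
    fix d assume "d \<in> {d. d dvd n}"
    then have d: "d dvd n" by simp
    then show "\<Prod>(prime_factors d) = d"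
      using n squarefree_mono prod_prime_factors_squarefree by blast
    show "prime_factors d \<in> Pow ?P"
      using d n0 by (simp add: dvd_prime_factors)
  qed
  finally show ?thesis .
qed

lemma moebius_mu_mult:
  assumes "coprime a b" "squarefree a" "squarefree b"
  shows "moebius_mu (a * b) = moebius_mu a * moebius_mu b"
proof -
  have nz: "a \<noteq> 0" "b \<noteq> 0" using assms by (metis not_squarefree_0)+
  have "prime_factors a \<inter> prime_factors b = {}"
    using assms(1) by (auto simp: prime_factors_dvd dest: coprime_common_divisor_nat not_prime_unit coprime_common_divisor)
  then have "card (prime_factors (a * b)) = card (prime_factors a) + card (prime_factors b)"
    using nz by (simp add: prime_factors_product card_Un_disjoint)
  then show ?thesis
    using assms by (simp add: moebius_mu_def squarefree_mult_coprime power_add)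
qed

text \<open>The gcd divides \<open>N\<close>, also for \<open>j = k = 0\<close>, hence is
  squarefree. The index set is enlarged to all divisors of \<open>N\<close>, independent of
  \<open>j\<close> and \<open>k\<close>, so that the sum can be interchanged with the one over the
  lattice.\<close>

lemma comb_coeff_gcd:
  assumes "squarefree N"
  shows "comb_coeff (nat (gcd (gcd j k) (int N))) =
    (\<Sum>d | d dvd N. if int d dvd j \<and> int d dvd k then moebius_mu d * int d else 0)"
proof -
  let ?g = "nat (gcd (gcd j k) (int N))"
  have N: "N \<noteq> 0" using assms by (metis not_squarefree_0)
  have g: "d dvd ?g \<longleftrightarrow> d dvd N \<and> int d dvd j \<and> int d dvd k" for d
  proof -
    have "d dvd ?g \<longleftrightarrow> int d dvd int ?g"
      by (simp only: int_dvd_int_iff)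
    also have "int ?g = gcd (gcd j k) (int N)"
      by simp
    finally show ?thesis by auto
  qed
  have "squarefree ?g"
    by (rule squarefree_mono[OF conjunct1[OF iffD1[OF g dvd_refl]] assms])
  then have "comb_coeff ?g = (\<Sum>d | d dvd ?g. moebius_mu d * int d)"
    by (rule comb_coeff_eq_sum_divisors)
  also have "{d. d dvd ?g} = {d \<in> {d. d dvd N}. int d dvd j \<and> int d dvd k}"
    by (simp only: g mem_Collect_eq)
  also have "(\<Sum>d\<in>\<dots>. moebius_mu d * int d) =
      (\<Sum>d | d dvd N. if int d dvd j \<and> int d dvd k then moebius_mu d * int d else 0)"
    using N by (intro sum.inter_filter) simp
  finally show ?thesis .
qed

text \<open>By coprimality a divisor \<open>d\<close> is the product of \<open>gcd d Q\<close> and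
  \<open>gcd d R\<close>, and each pair of divisors arises once. \<open>Q2\<close> is determined by
  \<open>Q1\<close> because \<open>Q > 0\<close>.\<close>

lemma sum_divisors_mult_coprime:
  fixes Q R :: nat and F :: "nat \<Rightarrow> 'a::comm_monoid_add"
  assumes "coprime Q R" "Q > 0"
  shows "(\<Sum>d | d dvd R * Q. F d) = (\<Sum>(Q1, Q2) | Q1 * Q2 = Q. \<Sum>R1 | R1 dvd R. F (Q1 * R1))"
proof -
  have "(\<Sum>d | d dvd R * Q. F d) = (\<Sum>(Q1, R1)\<in>{Q1. Q1 dvd Q} \<times> {R1. R1 dvd R}. F (Q1 * R1))"
  proof (rule sum.reindex_bij_witness[of _ "\<lambda>(Q1, R1). Q1 * R1" "\<lambda>d. (gcd d Q, gcd d R)"])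
    have gcds: "gcd (a * b) Q = a" "gcd (a * b) R = b" if "a dvd Q" "b dvd R" for a b
    proof -
      have "coprime Q b" "coprime R a"
        using assms(1) that coprime_divisors[of Q Q b R] coprime_divisors[of R R a Q]
        by (auto simp: coprime_commute)
      then show "gcd (a * b) Q = a" "gcd (a * b) R = b"
        using that by (simp_all add: gcd_mult_left_right_cancel gcd_mult_left_left_cancel gcd_nat.absorb1)
    qed
    {
      fix d assume "d \<in> {d. d dvd R * Q}"
      then have "d dvd Q * R" by (simp add: mult.commute)
      then obtain a b where "d = a * b" "a dvd Q" "b dvd R"
        by (elim division_decomp[THEN exE] exE conjE)
      then have "gcd d Q * gcd d R = d"
        by (simp add: gcds)
      then show "(case (gcd d Q, gcd d R) of (Q1, R1) \<Rightarrow> Q1 * R1) = d"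
        "(case (gcd d Q, gcd d R) of (Q1, R1) \<Rightarrow> F (Q1 * R1)) = F d" by simp_all
    next
      fix z assume "z \<in> {Q1. Q1 dvd Q} \<times> {R1. R1 dvd R}"
      then obtain a b where z: "z = (a, b)" and ab: "a dvd Q" "b dvd R" by auto
      show "(gcd (case z of (Q1, R1) \<Rightarrow> Q1 * R1) Q, gcd (case z of (Q1, R1) \<Rightarrow> Q1 * R1) R) = z"
        by (simp add: z gcds[OF ab])
      show "(case z of (Q1, R1) \<Rightarrow> Q1 * R1) \<in> {d. d dvd R * Q}"
        using mult_dvd_mono[OF ab] by (simp add: z mult.commute)
    }
  qed auto
  also have "\<dots> = (\<Sum>Q1 | Q1 dvd Q. \<Sum>R1 | R1 dvd R. F (Q1 * R1))"
    by (rule sum.cartesian_product[symmetric])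
  also have "\<dots> = (\<Sum>(Q1, Q2) | Q1 * Q2 = Q. \<Sum>R1 | R1 dvd R. F (Q1 * R1))"
    by (rule sum.reindex_bij_witness[of _ fst "\<lambda>Q1. (Q1, Q div Q1)"]) (use assms in auto)
  finally show ?thesis .
qed

section \<open>Sums of the Wigner function over sublattices\<close>

lemma has_sum_sum:
  fixes f :: "'i \<Rightarrow> 'a \<Rightarrow> 'b::topological_comm_monoid_add"
  assumes "\<And>i. i \<in> I \<Longrightarrow> (f i has_sum s i) A"
  shows "((\<lambda>x. \<Sum>i\<in>I. f i x) has_sum (\<Sum>i\<in>I. s i)) A"
  using assms by (induction I rule: infinite_finite_induct) (auto intro: has_sum_add)

text \<open>The set where a continuous function is nonzero is open, hence lies in the interior of
  the interval. The strict inequalities let \<open>lattice_point_eq_1\<close> exclude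
  \<open>i * l = 2\<close> and \<open>i * l = 0\<close>.\<close>

lemma nonzero_imp_interior_supp:
  assumes "C2 f" "supp f \<subseteq> {a..b}" "f x \<noteq> 0"
  shows "a < x \<and> x < b"
proof -
  have "open {x. f x \<noteq> 0}"
    by (intro open_Collect_neq C2_continuous assms(1) continuous_intros)
  moreover have "{x. f x \<noteq> 0} \<subseteq> {a..b}"
    by (rule subset_trans[OF closure_subset assms(2)[unfolded supp_def]])
  ultimately have "{x. f x \<noteq> 0} \<subseteq> interior {a..b}"
    by (intro interior_maximal)
  from subsetD[OF this, of x] show ?thesis using assms(3) by simp
qed

lemma lattice_point_eq_1:
  fixes a b c :: real and i l :: int
  assumes ab: "a * b = of_int (i * l)" and sgn: "a = of_int i * c" "c > 0"
    and s: "1 < a + b" "a + b < 2 powr (3/2)" and d: "- 1 < a - b" "a - b < 1"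
  shows "i = 1 \<and> l = 1"
proof -
  \<comment> \<open>\<open>4 i l = (a + b)\<^sup>2 - (a - b)\<^sup>2\<close> lies strictly between \<open>0\<close> and \<open>8\<close>, so \<open>i l = 1\<close>.\<close>
  have "4 * of_int (i * l) = (a + b)\<^sup>2 - (a - b)\<^sup>2"
    unfolding ab[symmetric] by (simp add: power2_eq_square algebra_simps)
  moreover have "(a - b)\<^sup>2 < 1" "0 \<le> (a - b)\<^sup>2"
    using d by (auto simp: abs_square_less_1)
  moreover have "(a + b)\<^sup>2 < (2 powr (3/2))\<^sup>2"
    using s by (intro power_strict_mono) auto
  moreover have "(2 powr (3/2))\<^sup>2 = (8::real)"
    by (simp add: powr_power)
  moreover have "1 < (a + b)\<^sup>2"
    using s by (simp add: one_less_power)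
  ultimately have "0 < real_of_int (i * l)" "real_of_int (i * l) < 2"
    by linarith+
  then have il: "i * l = 1" by linarith
  then have "i = 1 \<and> l = 1 \<or> i = - 1 \<and> l = - 1"
    by (metis pos_zmult_eq_1_iff_lemma zmult_eq_1_iff)
  \<comment> \<open>With \<open>i = - 1\<close> the number \<open>a\<close> is negative, and so is
    \<open>b\<close> because \<open>a * b = 1\<close>, against \<open>a + b > 1\<close>.\<close>
  moreover have "i \<noteq> - 1"
  proof
    assume "i = - 1"
    then have "a < 0" using sgn by simp
    moreover have "a * b = 1" using ab il by simp
    ultimately have "b < 0" by (metis less_eq_real_def not_less zero_less_mult_pos2 mult_nonneg_nonpos2 not_one_le_zero zero_less_mult_iff zero_less_one)
    with \<open>i = - 1\<close> sgn s show False by simp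
  qed
  ultimately show ?thesis by auto
qed

lemma Wig_eq: "Wig v u (x, \<xi>) = (LINT t|lborel. (cnj (v (x + t)) * u (x - t)) * cis (2 * pi * \<xi> * t))"
  by (simp add: Wig_def cis_conv_exp mult_ac)

text \<open>This is one column of the lattice of \<open>d\<close>, scaled by \<open>1 / Q\<close>.
  The frequencies are \<open>k / T\<close> with \<open>T = Q / d\<close>, so Poisson summation
  yields the points \<open>l * T\<close>; as \<open>x * (l * T) = i * l\<close>, only
  \<open>i = l = 1\<close> survives.\<close>

lemma has_sum_Wig_scaled:
  assumes v: "C2 v" "supp v \<subseteq> {1..2 powr (3/2)}" and u: "C2 u" "supp u \<subseteq> {-1..1}"
    and Q: "Q > 0" and d: "d > 0"
  shows "((\<lambda>k::int. Wig v u (of_int i * real d / real Q, real d * of_int k / real Q)) has_sum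
    (if i = 1 then of_real (real Q / real d) *
      (cnj (v (real d / real Q + real Q / real d)) * u (real d / real Q - real Q / real d)) else 0)) UNIV"
proof -
  define x where "x = of_int i * real d / real Q"
  define T where "T = real Q / real d"
  define f where "f t = cnj (v (x + t)) * u (x - t)" for t
  have T: "T > 0" using Q d by (simp add: T_def)
  have "C2 (\<lambda>t. cnj (v (x + 1 * t)) * u (x + (- 1) * t))"
    by (intro C2_mult C2_cnj C2_affine u v)
  then have f: "C2 f" by (simp add: f_def[abs_def])
  have nz: "1 < x + t \<and> x + t < 2 powr (3/2) \<and> - 1 < x - t \<and> x - t < 1" if "f t \<noteq> 0" for t
    using that nonzero_imp_interior_supp[OF v, of "x + t"] nonzero_imp_interior_supp[OF u, of "x - t"]
    by (auto simp: f_def)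
  \<comment> \<open>Here \<open>2 * t\<close> is the difference of \<open>x + t\<close> and
    \<open>x - t\<close>, so the bound on \<open>t\<close> is ample.\<close>
  have z: "f t = 0" if "\<bar>t\<bar> > 2 powr (3/2) + 1" for t
    using nz[of t] that by force
  have lat: "i = 1 \<and> l = 1" if "f (of_int l * T) \<noteq> 0" for l
  proof (rule lattice_point_eq_1)
    show "x * (of_int l * T) = of_int (i * l)"
      using Q d by (simp add: x_def T_def)
    show "x = of_int i * (real d / real Q)" "real d / real Q > 0"
      using Q d by (simp_all add: x_def)
  qed (use nz[OF that] in auto)
  have "((\<lambda>k::int. LINT t|lborel. f t * cis (2 * pi * (of_int k / T) * t)) has_sum
      of_real T * (\<Sum>l\<in>{1}. f (of_int l * T))) UNIV"
    by (rule poisson_summation[OF f z T]) (use lat in auto)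
  moreover have "of_real T * (\<Sum>l\<in>{1}. f (of_int l * T)) = (if i = 1 then of_real T * f T else 0)"
    using lat[of 1] by auto
  moreover have "(LINT t|lborel. f t * cis (2 * pi * (of_int k / T) * t)) =
      Wig v u (x, real d * of_int k / real Q)" for k
    unfolding Wig_eq f_def by (simp add: T_def mult.commute)
  ultimately show ?thesis
    by (simp add: x_def f_def T_def cong: if_cong)
qed

text \<open>The plane is summed column by column. Each column, extended by zero, has a sum over all
  pairs, and a finite sum of columns needs no summability argument in two variables.\<close>

lemma has_sum_Wig_sublattice:
  assumes v: "C2 v" "supp v \<subseteq> {1..2 powr (3/2)}" and u: "C2 u" "supp u \<subseteq> {-1..1}"
    and Q: "Q > 0" and d: "d > 0"
  shows "((\<lambda>(j, k). if int d dvd j \<and> int d dvd k then Wig v u (of_int j / real Q, of_int k / real Q) else 0)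
    has_sum of_real (real Q / real d) *
      (cnj (v (real d / real Q + real Q / real d)) * u (real d / real Q - real Q / real d))) UNIV"
    (is "(?G has_sum ?V) _")
proof -
  \<comment> \<open>The Wigner function vanishes at \<open>(x, \<xi>)\<close> unless \<open>0 < x < 3\<close>, so finitely many \<open>j\<close> contribute.\<close>
  define I where "I = insert 1 {0..3 * int Q}"
  have slice: "((\<lambda>z. if fst z = int d * i then ?G z else 0) has_sum (if i = 1 then ?V else 0)) UNIV" for i
  proof -
    let ?h = "\<lambda>k. (int d * i, int d * k)"
    have "((\<lambda>k. ?G (?h k)) has_sum (if i = 1 then ?V else 0)) UNIV"
      using has_sum_Wig_scaled[OF v u Q d, of i] by (simp add: mult.commute)
    moreover have "inj ?h"
      using d by (auto simp: inj_on_def)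
    ultimately have "(?G has_sum (if i = 1 then ?V else 0)) (range ?h)"
      by (simp add: has_sum_reindex o_def)
    \<comment> \<open>Points of the column \<open>fst z = d * i\<close> outside the range have
      second coordinate not divisible by \<open>d\<close>, where \<open>?G\<close> is zero.\<close>
    then show ?thesis
      by (rule has_sum_cong_neutral[THEN iffD1, rotated -1]) (auto simp: image_iff elim!: dvdE)
  qed
  have "((\<lambda>z. \<Sum>i\<in>I. if fst z = int d * i then ?G z else 0) has_sum (\<Sum>i\<in>I. if i = 1 then ?V else 0)) UNIV"
    by (rule has_sum_sum[OF slice])
  moreover have "(\<Sum>i\<in>I. if i = 1 then ?V else 0) = ?V"
    by (simp add: I_def)
  moreover have "(\<Sum>i\<in>I. if fst z = int d * i then ?G z else 0) = ?G z" for z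
  proof (cases "\<exists>i\<in>I. fst z = int d * i")
    case True
    then obtain i where i: "i \<in> I" "fst z = int d * i" by blast
    \<comment> \<open>As \<open>d > 0\<close>, a point lies in at most one column.\<close>
    then have "(\<Sum>i'\<in>I. if fst z = int d * i' then ?G z else 0) = (\<Sum>i'\<in>I. if i' = i then ?G z else 0)"
      using d by (intro sum.cong) auto
    then show ?thesis
      using i by (simp add: I_def)
  next
    case False
    have "Wig v u (of_int j / real Q, \<xi>) = 0" if dj: "int d dvd j" "j = fst z" for j \<xi>
    proof -
      obtain i where i: "j = int d * i" using dj(1) by (elim dvdE)
      then have "i \<notin> I" using False dj by auto
      then have "i < 0 \<or> i > 3 * int Q" by (auto simp: I_def)
      moreover have "j \<ge> i" if "i > 0"
        using that d i mult_right_mono[of 1 "int d" i] by simp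
      moreover have "j < 0" if "i < 0"
        using that d i by (simp add: mult_pos_neg)
      ultimately have "j < 0 \<or> j > 3 * int Q" by force
      then have x: "of_int j / real Q < 0 \<or> of_int j / real Q > 3"
        using Q by (auto simp: divide_simps)
      have "cnj (v (of_int j / real Q + t)) * u (of_int j / real Q - t) = 0" for t
      proof (rule ccontr)
        assume "\<not> ?thesis"
        then have "1 < of_int j / real Q + t" "of_int j / real Q + t < 2 powr (3/2)"
          "- 1 < of_int j / real Q - t" "of_int j / real Q - t < 1"
          using nonzero_imp_interior_supp[OF v, of "of_int j / real Q + t"]
            nonzero_imp_interior_supp[OF u, of "of_int j / real Q - t"] by auto
        \<comment> \<open>The crude bound 4 suffices: adding the constraints on \<open>x + t\<close>
          and \<open>x - t\<close> gives \<open>0 < 2 * x < 5\<close>.\<close>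
        moreover have "2 powr (3/2) \<le> (2::real) powr 2"
          by (intro powr_mono) auto
        ultimately show False using x by simp
      qed
      then show ?thesis unfolding Wig_eq by (simp only: mult_zero_left integral_zero)
    qed
    moreover have "(\<Sum>i\<in>I. if fst z = int d * i then ?G z else 0) = 0"
      using False by (intro sum.neutral) auto
    ultimately show ?thesis by (cases z) auto
  qed
  ultimately show ?thesis by simp
qed

section \<open>Assembling the formula\<close>

theorem theorem7p2:
  fixes N R Q :: nat and u v :: "real \<Rightarrow> complex"
  assumes "N > 0" "R > 0" "Q > 0"
    and "N = R * Q" and "squarefree N" and "odd N"
    and "smooth v" and "supp v \<subseteq> {1..2 powr (3/2)}"
    and "smooth u" and "supp u \<subseteq> {-1..1}"
    and "\<And>p::nat. prime p \<Longrightarrow> odd p \<Longrightarrow> real p < (1 + 2 powr (3/2)) / 2 \<Longrightarrow> p dvd N"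
  shows "pairing v (Psi (euler_power (real Q) (dirac_comb N)) u) =
    (\<Sum>(Q1, Q2) | Q1 * Q2 = Q. of_int (moebius_mu Q1) *
      (\<Sum>R1 | R1 dvd R. of_int (moebius_mu R1) *
        cnj (v (real R1 / real Q2 + real Q2 / real R1)) *
        u (real R1 / real Q2 - real Q2 / real R1)))"
proof -
  define W where "W j k = Wig v u (of_int j / real Q, of_int k / real Q)" for j k :: int
  define V where "V d = cnj (v (real d / real Q + real Q / real d)) * u (real d / real Q - real Q / real d)" for d
  have sub: "((\<lambda>(j, k). if int d dvd j \<and> int d dvd k then W j k else 0) has_sum
      of_real (real Q / real d) * V d) UNIV" if "d dvd N" for d
    unfolding W_def V_def
    by (intro has_sum_Wig_sublattice smooth_imp_C2 assms dvd_pos_nat[OF \<open>N > 0\<close> that])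
  have "((\<lambda>z. \<Sum>d | d dvd N. of_int (moebius_mu d * int d) *
      (case z of (j, k) \<Rightarrow> if int d dvd j \<and> int d dvd k then W j k else 0)) has_sum
    (\<Sum>d | d dvd N. of_int (moebius_mu d * int d) * (of_real (real Q / real d) * V d))) UNIV"
    by (intro has_sum_sum has_sum_cmult_right sub) simp
  moreover have "(\<Sum>d | d dvd N. of_int (moebius_mu d * int d) *
      (case z of (j, k) \<Rightarrow> if int d dvd j \<and> int d dvd k then W j k else 0)) =
    (case z of (j, k) \<Rightarrow> of_int (comb_coeff (nat (gcd (gcd j k) (int N)))) * W j k)" for z :: "int \<times> int"
    by (cases z) (auto simp: comb_coeff_gcd[OF assms(5)] sum_distrib_right intro!: sum.cong)
  \<comment> \<open>The factor \<open>d\<close> in the weight cancels the \<open>d\<close> in the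
    factor \<open>Q / d\<close> from Poisson summation.\<close>
  moreover have "of_int (moebius_mu d * int d) * (of_real (real Q / real d) * V d) =
      of_real (real Q) * (of_int (moebius_mu d) * V d)" if "d dvd N" for d
    using that \<open>N > 0\<close> by (auto simp: field_simps)
  ultimately have comb: "((\<lambda>(j, k). of_int (comb_coeff (nat (gcd (gcd j k) (int N)))) * W j k) has_sum
      of_real (real Q) * (\<Sum>d | d dvd N. of_int (moebius_mu d) * V d)) UNIV"
    by (simp add: sum_distrib_left)
  \<comment> \<open>The square of a common divisor of \<open>Q\<close> and \<open>R\<close> divides
    \<open>N\<close>.\<close>
  have cop: "coprime Q R"
    using assms(4,5) by (metis coprimeI squarefree_def mult.commute mult_dvd_mono power2_eq_square)
  \<comment> \<open>The infinite sum in \<open>dirac_comb\<close> would default to 0 without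
    convergence; \<open>comb\<close> supplies both convergence and value. The factor
    \<open>Q\<close> of \<open>euler_power\<close> and the \<open>Q\<close> from Poisson summation
    cancel the \<open>Q^2\<close> of \<open>dilate\<close>.\<close>
  have "pairing v (Psi (euler_power (real Q) (dirac_comb N)) u) =
      of_real (real Q) * (of_real (real Q) * (\<Sum>d | d dvd N. of_int (moebius_mu d) * V d) / of_real (real Q ^ 2))"
    using infsumI[OF comb] unfolding pairing_Psi euler_power_def dilate_def dirac_comb_def delta2_def W_def
    by simp
  also have "\<dots> = (\<Sum>d | d dvd R * Q. of_int (moebius_mu d) * V d)"
    using \<open>Q > 0\<close> \<open>N = R * Q\<close> by (simp add: power2_eq_square)
  also have "(\<Sum>d | d dvd R * Q. of_int (moebius_mu d) * V d) =
      (\<Sum>(Q1, Q2) | Q1 * Q2 = Q. \<Sum>R1 | R1 dvd R. of_int (moebius_mu (Q1 * R1)) * V (Q1 * R1))"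
    by (rule sum_divisors_mult_coprime[OF cop \<open>Q > 0\<close>])
  also have "\<dots> = (\<Sum>(Q1, Q2) | Q1 * Q2 = Q. of_int (moebius_mu Q1) *
      (\<Sum>R1 | R1 dvd R. of_int (moebius_mu R1) *
        cnj (v (real R1 / real Q2 + real Q2 / real R1)) *
        u (real R1 / real Q2 - real Q2 / real R1)))"
  proof (rule sum.cong[OF refl], clarify)
    fix Q1 Q2 assume Q: "Q = Q1 * Q2"
    show "(\<Sum>R1 | R1 dvd R. of_int (moebius_mu (Q1 * R1)) * V (Q1 * R1)) = of_int (moebius_mu Q1) *
      (\<Sum>R1 | R1 dvd R. of_int (moebius_mu R1) *
        cnj (v (real R1 / real Q2 + real Q2 / real R1)) *
        u (real R1 / real Q2 - real Q2 / real R1))"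
      unfolding sum_distrib_left
    proof (rule sum.cong[OF refl])
      fix R1 assume "R1 \<in> {R1. R1 dvd R}"
      then have R1: "R1 dvd R" by simp
      have "squarefree Q1" "squarefree R1"
        using assms(4,5) Q R1 by (auto intro: squarefree_mono[of _ N])
      moreover have "coprime Q1 R1"
        using cop Q R1 coprime_divisors[of Q1 Q R1 R] by simp
      ultimately have m: "moebius_mu (Q1 * R1) = moebius_mu Q1 * moebius_mu R1"
        by (intro moebius_mu_mult)
      have "Q1 > 0" using Q \<open>Q > 0\<close> by auto
      then have "real (Q1 * R1) / real Q = real R1 / real Q2" "real Q / real (Q1 * R1) = real Q2 / real R1"
        by (simp_all add: Q)
      then show "of_int (moebius_mu (Q1 * R1)) * V (Q1 * R1) = of_int (moebius_mu Q1) *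
          (of_int (moebius_mu R1) * cnj (v (real R1 / real Q2 + real Q2 / real R1)) *
            u (real R1 / real Q2 - real Q2 / real R1))"
        unfolding V_def m by (simp only: of_int_mult mult.assoc)
    qed
  qed
  finally show ?thesis .
qed

end
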